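(* Let $N\in\mathbb{N}$ and $\gamma\in\mathcal{PW}_{\le N}$. If a subset $B_\gamma\subset\mathcal{W}_{\le N}(\gamma)$ is a basis of words for $\mathcal{W}_N(\gamma)$, then $$\mathrm{Card}(B_\gamma)=\binom{N}{\|\gamma\|}\quad\text{and}\quad \forall m\in\{\|\gamma\|,\dots,N-1\},\ \ \mathrm{Card}(B_\gamma\cap\mathcal{W}_{\le m})\le\binom{m}{\|\gamma\|}.$$
   Context: $\mathbb{N}=\{0,1,2,\dots\}$. Fix an integer $d\ge 1$ and the alphabet $\mathcal{A}=\{0,1,\dots,d\}$. $\mathcal{W}_N$ is the set of words of length $N$ over $\mathcal{A}$ (with $\mathcal{W}_0=\{\epsilon\}$, $\epsilon$ the empty word), $\mathcal{W}_{\le N}=\bigsqcup_{k=0}^N\mathcal{W}_k$, $\mathcal{W}_{<\infty}=\bigsqcup_{k\ge0}\mathcal{W}_k$; $\|w\|$ is the length of a word $w$; $0_k$ is the word made of $k$ letters $0$ ($0_0=\epsilon$). For a set $C$ of words, $\mathrm{Span}(C)$ is the real vector space of formal finite linear combinations of elements of $C$. Concatenation of words is extended bilinearly to $\mathrm{Span}(\mathcal{W}_{<\infty})$. The shuffle product $\sqcup\!\sqcup$ is defined inductively by $w\sqcup\!\sqcup\epsilon=\epsilon\sqcup\!\sqcup w=w$ and $(wi)\sqcup\!\sqcup(vj)=(w\sqcup\!\sqcup(vj))i+((wi)\sqcup\!\sqcup v)j$ for words $w,v$ and letters $i,j$, and extended bilinearly. For a word $w$, $P(w)$ is the word obtained by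 deleting all letters $0$ from $w$. $\mathcal{PW}_{\le N}=P(\mathcal{W}_{\le N})$ is the set of words of length at most $N$ with no letter $0$ (pure words). For $\gamma\in \mathcal{PW}_{\le N}$: $\mathcal{W}_N(\gamma)=\{w\in\mathcal{W}_N: P(w)=\gamma\}$ and $\mathcal{W}_{\le N}(\gamma)=\{w\in\mathcal{W}_{\le N}:P(w)=\gamma\}$. A subset $B\subset\mathcal{W}_{\le N}(\gamma)$ is a basis of words for $\mathcal{W}_N(\gamma)$ if the family $(w\sqcup\!\sqcup 0_{N-\|w\|})_{w\in B}$ is a basis of $\mathrm{Span}(\mathcal{W}_N(\gamma))$. *)

theory Defs
  imports "HOL-Analysis.Finite_Function_Topology"
begin

(* Letters are natural numbers; the alphabet {0..d} is imposed by the sets of words below.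
   Formal linear combinations of words are finitely supported functions; their
   real_vector structure is that of HOL-Analysis.Finite_Function_Topology. *)
type_synonym word = "nat list"
type_synonym word_comb = "word \<Rightarrow>\<^sub>0 real"

definition words :: "nat \<Rightarrow> nat \<Rightarrow> word set" where
  "words d N = {w. set w \<subseteq> {0..d} \<and> length w = N}"

definition words_le :: "nat \<Rightarrow> nat \<Rightarrow> word set" where
  "words_le d N = (\<Union>k\<in>{0..N}. words d k)"

definition zeros :: "nat \<Rightarrow> word" where
  "zeros k = replicate k 0"

definition of_word :: "word \<Rightarrow> word_comb" where
  "of_word w = Poly_Mapping.single w 1"

definition Span :: "word set \<Rightarrow> word_comb set" where
  "Span C = span (of_word ` C)"

(* Bilinear extension of concatenation. *)
definition conc :: "word_comb \<Rightarrow> word_comb \<Rightarrow> word_comb" where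
  "conc p q = (\<Sum>u\<in>Poly_Mapping.keys p. \<Sum>v\<in>Poly_Mapping.keys q.
     (Poly_Mapping.lookup p u * Poly_Mapping.lookup q v) *\<^sub>R of_word (u @ v))"

(* The recursion removes last letters. Unlike List.shuffles, which is a set,
   the result records multiplicities. *)
function shuffle :: "word \<Rightarrow> word \<Rightarrow> word_comb" where
  "shuffle w [] = of_word w"
| "shuffle [] w = of_word w"
| "shuffle (w @ [i]) (v @ [j]) =
     conc (shuffle w (v @ [j])) (of_word [i]) + conc (shuffle (w @ [i]) v) (of_word [j])"
  by (auto, metis rev_exhaust)
termination
  by (relation "measure (\<lambda>(w, v). length w + length v)") auto

definition pure_part :: "word \<Rightarrow> word" where
  "pure_part w = filter (\<lambda>i. i \<noteq> 0) w"

definition pure_words_le :: "nat \<Rightarrow> nat \<Rightarrow> word set" where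
  "pure_words_le d N = pure_part ` words_le d N"

definition words_over :: "nat \<Rightarrow> nat \<Rightarrow> word \<Rightarrow> word set" where
  "words_over d N \<gamma> = {w \<in> words d N. pure_part w = \<gamma>}"

definition words_le_over :: "nat \<Rightarrow> nat \<Rightarrow> word \<Rightarrow> word set" where
  "words_le_over d N \<gamma> = {w \<in> words_le d N. pure_part w = \<gamma>}"

(* Basis as a family indexed by I: injectivity rules out repeated vectors,
   which independence of the image alone would not detect. *)
definition is_basis_family :: "('i \<Rightarrow> 'v::real_vector) \<Rightarrow> 'i set \<Rightarrow> 'v set \<Rightarrow> bool" where
  "is_basis_family f I V \<longleftrightarrow> inj_on f I \<and> independent (f ` I) \<and> span (f ` I) = V"

definition basis_of_words :: "nat \<Rightarrow> nat \<Rightarrow> word \<Rightarrow> word set \<Rightarrow> bool" where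
  "basis_of_words d N \<gamma> B \<longleftrightarrow>
     B \<subseteq> words_le_over d N \<gamma> \<and>
     is_basis_family (\<lambda>w. shuffle w (zeros (N - length w))) B (Span (words_over d N \<gamma>))"

end

theory Submission
  imports Defs
begin

text \<open>Shuffling with a single letter \<open>0\<close> is a linear operator \<open>D\<close> that sends
  \<open>Span (words_over d k \<gamma>)\<close> into \<open>Span (words_over d (k + 1) \<gamma>)\<close>, and
  \<open>D\<^sup>k w\<close> is \<open>k!\<close> times the shuffle of \<open>w\<close> with \<open>k\<close> zeros.  Hence for every word
  \<open>w\<close> over \<open>\<gamma>\<close> of length at most \<open>m\<close>, the shuffle of \<open>w\<close> with \<open>N - \<parallel>w\<parallel>\<close> zeros lies in the
  image of \<open>Span (words_over d m \<gamma>)\<close> under \<open>D\<^sup>N\<^sup>-\<^sup>m\<close>, a space of dimension at most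
  \<open>m choose \<parallel>\<gamma>\<parallel>\<close>.\<close>

section \<open>Formal linear combinations of words\<close>

lemma lookup_scaleR: "Poly_Mapping.lookup (r *\<^sub>R x) i = r *\<^sub>R Poly_Mapping.lookup x i"
  for x :: "'a \<Rightarrow>\<^sub>0 'b::real_vector"
proof -
  have "finite {i. r *\<^sub>R Poly_Mapping.lookup x i \<noteq> 0}"
    by (rule finite_subset[OF _ finite_lookup[of x]]) auto
  then show ?thesis
    by (simp add: scaleR_poly_mapping_def)
qed

text \<open>Words are a basis of the space of combinations, so this is the linear map prescribed on
  that basis. Both \<open>snoc\<close> and \<open>insert_zero\<close> are instances, which gives
  their linearity at once.\<close>

definition lin_ext :: "(word \<Rightarrow> 'v::real_vector) \<Rightarrow> word_comb \<Rightarrow> 'v" where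
  "lin_ext f p = (\<Sum>u\<in>Poly_Mapping.keys p. Poly_Mapping.lookup p u *\<^sub>R f u)"

text \<open>Terms cancel in sums, so supports vary; this lets \<open>p\<close>, \<open>q\<close> and
  \<open>p + q\<close> be summed over one common index set.\<close>

lemma lin_ext_superset:
  assumes "finite K" "Poly_Mapping.keys p \<subseteq> K"
  shows "lin_ext f p = (\<Sum>u\<in>K. Poly_Mapping.lookup p u *\<^sub>R f u)"
  unfolding lin_ext_def using assms by (intro sum.mono_neutral_left) (auto simp: in_keys_iff)

lemma linear_lin_ext: "linear (lin_ext f)"
proof (rule linearI)
  fix p q :: word_comb
  let ?K = "Poly_Mapping.keys p \<union> Poly_Mapping.keys q"
  have "lin_ext f (p + q) = (\<Sum>u\<in>?K. Poly_Mapping.lookup (p + q) u *\<^sub>R f u)"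
    by (intro lin_ext_superset) (use keys_add[of p q] in auto)
  also have "\<dots> = (\<Sum>u\<in>?K. Poly_Mapping.lookup p u *\<^sub>R f u) + (\<Sum>u\<in>?K. Poly_Mapping.lookup q u *\<^sub>R f u)"
    by (simp add: lookup_add scaleR_add_left sum.distrib)
  also have "\<dots> = lin_ext f p + lin_ext f q"
    by (subst (1 2) lin_ext_superset[where K = ?K]) auto
  finally show "lin_ext f (p + q) = lin_ext f p + lin_ext f q" .
next
  fix r :: real and p :: word_comb
  have "lin_ext f (r *\<^sub>R p) = (\<Sum>u\<in>Poly_Mapping.keys p. Poly_Mapping.lookup (r *\<^sub>R p) u *\<^sub>R f u)"
    by (intro lin_ext_superset) (auto simp: in_keys_iff lookup_scaleR)
  then show "lin_ext f (r *\<^sub>R p) = r *\<^sub>R lin_ext f p"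
    by (simp add: lin_ext_def lookup_scaleR scaleR_sum_right)
qed

lemma lin_ext_of_word [simp]: "lin_ext f (of_word w) = f w"
  by (simp add: lin_ext_def of_word_def)

lemma lin_ext_of_word_id: "lin_ext of_word p = p"
  by (rule poly_mapping_eqI)
    (auto simp: lin_ext_def of_word_def lookup_sum lookup_scaleR lookup_single when_def
      if_distrib in_keys_iff cong: if_cong)

lemma span_of_word: "span (range of_word) = UNIV"
proof -
  have "lin_ext of_word p \<in> span (range of_word)" for p
    unfolding lin_ext_def by (intro span_sum span_scale span_base) auto
  then show ?thesis
    by (auto simp: lin_ext_of_word_id)
qed

lemma linear_eq_of_word:
  assumes "linear f" "linear g" "\<And>w. f (of_word w) = g (of_word w)"
  shows "f p = g p"
  by (rule linear_eq_on_span[OF assms(1,2), of "range of_word"]) (use assms(3) span_of_word in auto)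

lemma inj_of_word: "inj of_word"
  unfolding of_word_def by (rule injI) (metis keys_single singleton_inject zero_neq_one)

text \<open>The coordinate functional at \<open>w\<close> vanishes on all other words but equals 1
  at \<open>of_word w\<close>.\<close>

lemma independent_of_word: "independent (of_word ` C)"
proof
  assume "dependent (of_word ` C)"
  then obtain w where w: "of_word w \<in> span (of_word ` C - {of_word w})"
    by (auto simp: dependent_def)
  have "linear (\<lambda>p::word_comb. Poly_Mapping.lookup p w)"
    by (rule linearI) (auto simp: lookup_add lookup_scaleR)
  moreover have "Poly_Mapping.lookup v w = 0" if "v \<in> of_word ` C - {of_word w}" for v
    using that by (auto simp: of_word_def lookup_single when_def)
  ultimately have "Poly_Mapping.lookup (of_word w) w = 0"
    using linear_eq_0_on_span[OF _ _ w] by blast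
  then show False
    by (simp add: of_word_def)
qed

section \<open>Shuffling with zeros\<close>

abbreviation snoc :: "nat \<Rightarrow> word_comb \<Rightarrow> word_comb" where
  "snoc i p \<equiv> conc p (of_word [i])"

lemma snoc_eq_lin_ext: "snoc i = lin_ext (\<lambda>w. of_word (w @ [i]))"
  by (rule ext) (simp add: conc_def lin_ext_def of_word_def)

lemma linear_snoc: "linear (snoc i)"
  by (simp add: snoc_eq_lin_ext linear_lin_ext)

lemma snoc_of_word [simp]: "snoc i (of_word w) = of_word (w @ [i])"
  by (metis snoc_eq_lin_ext lin_ext_of_word)

text \<open>The operator \<open>D\<close> of the introduction.\<close>

definition insert_zero :: "word_comb \<Rightarrow> word_comb" where
  "insert_zero = lin_ext (\<lambda>w. shuffle w [0])"

lemma linear_insert_zero: "linear insert_zero"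
  by (simp add: insert_zero_def linear_lin_ext)

lemma insert_zero_of_word: "insert_zero (of_word w) = shuffle w [0]"
  by (simp add: insert_zero_def)

lemma shuffle_Nil_left [simp]: "shuffle [] w = of_word w"
  by (cases w rule: rev_cases) (auto simp: shuffle.simps)

lemma shuffle_snoc_zero: "shuffle (w @ [i]) [0] = snoc i (shuffle w [0]) + of_word (w @ [i, 0])"
  using shuffle.simps(3)[of w i "[]" 0] by simp

text \<open>The new 0 lands either before the last letter \<open>i\<close> or after it. On words
  this is the shuffle recursion, and linearity does the rest.\<close>

lemma insert_zero_snoc: "insert_zero (snoc i p) = snoc i (insert_zero p) + snoc 0 (snoc i p)"
proof (rule linear_eq_of_word[where p = p])
  show "linear (\<lambda>p. insert_zero (snoc i p))"
    using linear_compose[OF linear_snoc linear_insert_zero] by (simp add: o_def)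
  show "linear (\<lambda>p. snoc i (insert_zero p) + snoc 0 (snoc i p))"
    using linear_compose_add[OF linear_compose[OF linear_insert_zero linear_snoc]
        linear_compose[OF linear_snoc linear_snoc]]
    by (simp add: o_def)
qed (simp add: insert_zero_of_word shuffle_snoc_zero)

lemma zeros_Suc: "zeros (Suc k) = zeros k @ [0]"
  by (simp add: zeros_def replicate_append_same)

lemma shuffle_snoc_zeros:
  "shuffle (w @ [i]) (zeros (Suc k)) = snoc i (shuffle w (zeros (Suc k))) + snoc 0 (shuffle (w @ [i]) (zeros k))"
  by (simp add: zeros_Suc)

lemma insert_zero_zeros: "insert_zero (of_word (zeros k)) = real (Suc k) *\<^sub>R of_word (zeros (Suc k))"
proof (induction k)
  case 0
  then show ?case by (simp add: insert_zero_of_word zeros_def)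
next
  case (Suc k)
  have "insert_zero (of_word (zeros (Suc k))) = insert_zero (snoc 0 (of_word (zeros k)))"
    by (simp add: zeros_Suc)
  also have "\<dots> = real (Suc (Suc k)) *\<^sub>R of_word (zeros (Suc (Suc k)))"
    unfolding insert_zero_snoc Suc
    by (simp add: linear_scale[OF linear_snoc] linear_add[OF linear_snoc] zeros_Suc scaleR_add_left scaleR_2)
  finally show ?case .
qed

text \<open>This amounts to associativity of the shuffle, since shuffling \<open>zeros k\<close>
  with one 0 gives k+1 copies of \<open>zeros (Suc k)\<close>. It is obtained directly by a double
  induction: on \<open>w\<close> from its end, then on \<open>k\<close>.\<close>

lemma insert_zero_shuffle_zeros:
  "insert_zero (shuffle w (zeros k)) = real (Suc k) *\<^sub>R shuffle w (zeros (Suc k))"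
proof (induction w arbitrary: k rule: rev_induct)
  case Nil
  then show ?case by (simp add: insert_zero_zeros)
next
  case (snoc i w)
  note IH = snoc
  show ?case
  proof (induction k)
    case 0
    then show ?case by (simp add: insert_zero_of_word zeros_def)
  next
    case (Suc k)
    show ?case
      \<comment> \<open>The two terms whose new 0 is the last letter recombine, by the shuffle
        recursion, into one more copy of \<open>snoc 0 (shuffle (w @ [i]) (zeros (Suc k)))\<close>.
        Its coefficient thus rises from k+1 to k+2, matching the other summand.\<close>
      unfolding shuffle_snoc_zeros[of w i "k"] linear_add[OF linear_insert_zero] insert_zero_snoc
        IH Suc
      unfolding shuffle_snoc_zeros[of w i "Suc k"]
      by (simp add: linear_scale[OF linear_snoc] linear_add[OF linear_snoc] scaleR_add_left
          scaleR_add_right scaleR_2 shuffle_snoc_zeros[of w i k])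
  qed
qed

text \<open>The factors k+1, ..., k+j multiply up to the quotient of factorials.\<close>

lemma insert_zero_funpow_shuffle_zeros:
  "(insert_zero ^^ j) (shuffle w (zeros k)) = (fact (k + j) / fact k) *\<^sub>R shuffle w (zeros (k + j))"
proof (induction j)
  case (Suc j)
  then show ?case
    by (simp add: linear_scale[OF linear_insert_zero] insert_zero_shuffle_zeros field_simps
        del: of_nat_Suc)
qed simp

lemma linear_funpow:
  fixes f :: "'a::real_vector \<Rightarrow> 'a"
  assumes "linear f"
  shows "linear (f ^^ n)"
proof (induction n)
  case 0
  show ?case by (simp add: id_def linear_ident)
next
  case (Suc n)
  then show ?case by (simp add: linear_compose[OF _ assms] del: o_apply)
qed

section \<open>Words with a given pure part\<close>

lemma words_over_snoc:
  assumes "w \<in> words_over d k \<gamma>" "i \<le> d"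
  shows "w @ [i] \<in> words_over d (Suc k) (\<gamma> @ pure_part [i])"
  using assms by (auto simp: words_over_def words_def pure_part_def)

lemma snoc_Span_words_over:
  assumes "p \<in> Span (words_over d k \<gamma>)" "i \<le> d"
  shows "snoc i p \<in> Span (words_over d (Suc k) (\<gamma> @ pure_part [i]))"
proof -
  have "snoc i ` Span (words_over d k \<gamma>) = span (snoc i ` of_word ` words_over d k \<gamma>)"
    unfolding Span_def by (simp add: linear_span_image[OF linear_snoc])
  also have "\<dots> \<subseteq> Span (words_over d (Suc k) (\<gamma> @ pure_part [i]))"
    unfolding Span_def using assms(2) by (intro span_mono) (auto intro: words_over_snoc)
  finally show ?thesis using assms(1) by blast
qed

text \<open>Removing the last letter may shorten the pure part, so the induction must range over all
  \<open>\<gamma>\<close>.\<close>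

lemma shuffle_zero_in_Span:
  assumes "w \<in> words_over d k \<gamma>"
  shows "shuffle w [0] \<in> Span (words_over d (Suc k) \<gamma>)"
  using assms
proof (induction w arbitrary: k \<gamma> rule: rev_induct)
  case Nil
  then show ?case
    by (auto simp: words_over_def words_def pure_part_def Span_def intro!: span_base)
next
  case (snoc i w)
  let ?\<delta> = "pure_part w"
  from snoc.prems obtain l where l: "k = Suc l" "w \<in> words_over d l ?\<delta>" "i \<le> d"
    "\<gamma> = ?\<delta> @ pure_part [i]"
    by (cases k) (auto simp: words_over_def words_def pure_part_def)
  have "snoc i (shuffle w [0]) \<in> Span (words_over d (Suc k) \<gamma>)"
    using snoc_Span_words_over[OF snoc.IH[OF l(2)] l(3)] l(1,4) by simp
  moreover have "of_word (w @ [i, 0]) \<in> Span (words_over d (Suc k) \<gamma>)"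
    using words_over_snoc[OF snoc.prems, of 0]
    by (auto simp: Span_def pure_part_def intro!: span_base)
  ultimately show ?case
    unfolding shuffle_snoc_zero by (auto simp: Span_def intro: span_add)
qed

lemma insert_zero_funpow_in_Span:
  assumes "p \<in> Span (words_over d k \<gamma>)"
  shows "(insert_zero ^^ j) p \<in> Span (words_over d (k + j) \<gamma>)"
proof (induction j)
  case 0
  then show ?case using assms by simp
next
  case (Suc j)
  have "insert_zero ` Span (words_over d (k + j) \<gamma>) = span (insert_zero ` of_word ` words_over d (k + j) \<gamma>)"
    unfolding Span_def by (simp add: linear_span_image[OF linear_insert_zero])
  also have "\<dots> \<subseteq> Span (words_over d (Suc (k + j)) \<gamma>)"
    unfolding Span_def
    by (intro span_minimal subspace_span)
      (use shuffle_zero_in_Span in \<open>auto simp: insert_zero_of_word Span_def\<close>)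
  finally show ?case using Suc by auto
qed

lemma in_words_over_Suc_iff:
  "v \<in> words_over d (Suc n) \<gamma> \<longleftrightarrow> (\<exists>x w. v = x # w \<and> x \<le> d \<and>
    (if x = 0 then w \<in> words_over d n \<gamma> else \<exists>\<delta>. \<gamma> = x # \<delta> \<and> w \<in> words_over d n \<delta>))"
  by (cases v) (auto simp: words_over_def words_def pure_part_def)

lemma words_over_Suc_Nil: "words_over d (Suc n) [] = Cons 0 ` words_over d n []"
  by (auto simp: in_words_over_Suc_iff split: if_splits)

lemma words_over_Suc_Cons:
  assumes "g \<noteq> 0" "g \<le> d"
  shows "words_over d (Suc n) (g # \<gamma>) =
    Cons 0 ` words_over d n (g # \<gamma>) \<union> Cons g ` words_over d n \<gamma>"
  using assms by (auto simp: in_words_over_Suc_iff split: if_splits)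

text \<open>Pascal's rule: the first letter is either 0 or the first letter of
  \<open>\<gamma>\<close>, and these cases are disjoint because \<open>\<gamma>\<close> has no
  0.\<close>

lemma card_words_over:
  assumes "set \<gamma> \<subseteq> {1..d}"
  shows "finite (words_over d n \<gamma>) \<and> card (words_over d n \<gamma>) = n choose length \<gamma>"
  using assms
proof (induction n arbitrary: \<gamma>)
  case 0
  have "words_over d 0 \<gamma> = (if \<gamma> = [] then {[]} else {})"
    by (auto simp: words_over_def words_def pure_part_def)
  then show ?case by (cases \<gamma>) auto
next
  case (Suc n)
  show ?case
  proof (cases \<gamma>)
    case Nil
    then show ?thesis using Suc.IH[of "[]"] by (simp add: words_over_Suc_Nil card_image)
  next
    case (Cons g \<delta>)
    then have g: "g \<noteq> 0" "g \<le> d" and "set \<delta> \<subseteq> {1..d}" using Suc.prems by auto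
    then have "card (Cons 0 ` words_over d n (g # \<delta>) \<union> Cons g ` words_over d n \<delta>)
      = card (words_over d n (g # \<delta>)) + card (words_over d n \<delta>)"
      using Suc.IH[of "g # \<delta>"] Suc.IH[of \<delta>] Suc.prems Cons
      by (subst card_Un_disjoint) (auto simp: card_image)
    then show ?thesis
      using Suc.IH[of "g # \<delta>"] Suc.IH[of \<delta>] Suc.prems Cons
      by (simp add: words_over_Suc_Cons g)
  qed
qed

lemma pure_words_le_letters:
  assumes "\<gamma> \<in> pure_words_le d N"
  shows "set \<gamma> \<subseteq> {1..d}"
  using assms by (force simp: pure_words_le_def words_le_def words_def pure_part_def)

section \<open>Bases of words\<close>

lemma shuffle_zeros_in_image:
  assumes "w \<in> words_le d m" "pure_part w = \<gamma>" "m \<le> N"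
  shows "shuffle w (zeros (N - length w)) \<in>
    span ((insert_zero ^^ (N - m)) ` of_word ` words_over d m \<gamma>)"
proof -
  let ?l = "length w"
  let ?x = "(insert_zero ^^ (m - ?l)) (of_word w)"
  have l: "?l \<le> m" and w: "w \<in> words_over d ?l \<gamma>"
    using assms(1,2) by (auto simp: words_le_def words_def words_over_def)
  have "?x \<in> Span (words_over d m \<gamma>)"
    using insert_zero_funpow_in_Span[of "of_word w" d ?l \<gamma> "m - ?l"] w l
    by (auto simp: Span_def intro: span_base)
  then have "(insert_zero ^^ (N - m)) ?x \<in>
      span ((insert_zero ^^ (N - m)) ` of_word ` words_over d m \<gamma>)"
    unfolding Span_def by (simp add: linear_span_image[OF linear_funpow[OF linear_insert_zero]])
  \<comment> \<open>The exponents N-m and m-l add up to N-l. Reading \<open>w\<close> as its shuffle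
    with \<open>zeros 0\<close> makes the power formula apply with k = 0, so the factor is (N-l)!,
    which is then divided out.\<close>
  moreover have "(insert_zero ^^ (N - m)) ?x = (insert_zero ^^ (N - ?l)) (shuffle w (zeros 0))"
    using funpow_add[of "N - m" "m - ?l" insert_zero] l assms(3) by (simp add: zeros_def)
  then have "shuffle w (zeros (N - ?l)) = (1 / fact (N - ?l)) *\<^sub>R (insert_zero ^^ (N - m)) ?x"
    by (simp add: insert_zero_funpow_shuffle_zeros)
  ultimately show ?thesis
    by (auto intro: span_scale)
qed

theorem theorem2:
  fixes d N :: nat and \<gamma> :: word and B :: "word set"
  assumes "d \<ge> 1"
    and "\<gamma> \<in> pure_words_le d N"
    and "B \<subseteq> words_le_over d N \<gamma>"
    and "basis_of_words d N \<gamma> B"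
  shows "card B = N choose length \<gamma> \<and>
    (\<forall>m\<in>{length \<gamma>..<N}. card (B \<inter> words_le d m) \<le> m choose length \<gamma>)"
proof
  let ?f = "\<lambda>w. shuffle w (zeros (N - length w))"
  from assms(4) have inj: "inj_on ?f B" and ind: "independent (?f ` B)"
    and span: "span (?f ` B) = span (of_word ` words_over d N \<gamma>)"
    by (auto simp: basis_of_words_def is_basis_family_def Span_def)
  note words_over = card_words_over[OF pure_words_le_letters[OF assms(2)]]
  have "card B = card (?f ` B)"
    by (simp add: card_image inj)
  \<comment> \<open>Two independent families with the same span have the same cardinality.\<close>
  also have "\<dots> = card (of_word ` words_over d N \<gamma>)"
    using dim_eq_card[OF span[symmetric] independent_of_word] dim_eq_card_independent[OF ind]
    by simp
  also have "\<dots> = N choose length \<gamma>"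
    by (simp add: card_image inj_on_subset[OF inj_of_word] words_over)
  finally show "card B = N choose length \<gamma>" .
  show "\<forall>m\<in>{length \<gamma>..<N}. card (B \<inter> words_le d m) \<le> m choose length \<gamma>"
  proof
    fix m assume m: "m \<in> {length \<gamma>..<N}"
    \<comment> \<open>\<open>?T\<close> spans the image of the length-m space. Its size is at most
      the number of words over \<open>\<gamma>\<close> of length m, and this bounds any independent
      subset of its span.\<close>
    let ?C = "B \<inter> words_le d m" and ?T = "(insert_zero ^^ (N - m)) ` of_word ` words_over d m \<gamma>"
    have "?f ` ?C \<subseteq> span ?T"
      using m assms(3) by (intro image_subsetI shuffle_zeros_in_image) (auto simp: words_le_over_def)
    moreover have "independent (?f ` ?C)"
      by (rule independent_mono[OF ind]) auto
    ultimately have "card (?f ` ?C) \<le> card ?T"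
      using independent_span_bound[of ?T "?f ` ?C"] words_over by auto
    also have "\<dots> \<le> m choose length \<gamma>"
      using words_over[of m] by (metis card_image_le finite_imageI order_trans)
    finally show "card ?C \<le> m choose length \<gamma>"
      using inj by (simp add: card_image inj_on_subset)
  qed
qed

end
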